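(* Let $G=(V,E)$ be an arbitrary directed graph on the (possibly infinite) action set $V$ with maximum out-degree $D<\infty$, let $\mathrm{root}\in V$ be an arbitrarily chosen vertex, let $L\ge0$ be an integer, and let $\mathbf C$ be an edge-coloring of $G$ (a partition of $E$ into countably many classes) such that any two distinct edges leaving the same vertex have different colors. Suppose $\max_{a,b\in V}|u^t(a)-u^t(b)|\le\Delta$ for all $t$. Then $(\Delta/(L+1),L,\mathbf C)$-colored-regret-matching, after $T\ge1$ steps, has expected local colored regret satisfying $$\frac1T\,\mathbb{E}\big[R^T_{\mathrm{localcolor}}\big]\le\frac{\Delta D}{L+1}+\frac{\Delta\sqrt{D\,|C_L|}}{\sqrt T},$$ where $C_L=\{C\in\mathbf C:\ \exists (i,j)\in C\text{ with }\ell(i)\le L\}$.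
   Context: Online setting: at each time $t=1,2,\dots$ an action $a^t\in V$ is drawn from a distribution $\pi^t$ (chosen by the algorithm from the past), then a utility function $u^t:V\to\mathbb{R}$ is observed. The $u^t$ may depend arbitrarily on the past $a^1,\dots,a^{t-1},u^1,\dots,u^{t-1}$; given this past and $u^t$, the action $a^t$ has distribution $\pi^t$. Write $x^+=\max(x,0)$, $R^T_{a,b}=\sum_{t=1}^T\mathbf 1(a^t=a)(u^t(b)-u^t(a))$, and $R^T_{\mathrm{localcolor}}=\sum_{C\in\mathbf C}\big(\sum_{(i,j)\in C}R^T_{i,j}\big)^+$ (only finitely many nonzero terms). Level: $\ell(v)$ is the number of edges of a shortest directed path from $\mathrm{root}$ to $v$ ($\infty$ if none). Stationarity requirement with parameter $L$: given real numbers $\tilde R_{i,j}$, $(i,j)\in E$, put $M=\max_{(i,j)\in E}\tilde R^+_{i,j}$ (if $M=0$, all ratios $\tilde R^+_{i,j}/M$ are read as $0$). A vector $\pi=(\pi_j)_{j\in V}$ satisfies the requirement if (a) $\sum_{j\in V}\pi_j=1$ and $\pi_j\ge0$ for all $j$; (b) $\pi_j=0$ whenever $\ell(j)>L$; (c) for all $j$ with $1\le\ell(j)\le L$: $\pi_j=\sum_{i:(i,j)\in E}(\tilde R^+_{i,j}/M)\pi_i+\big(1-\sum_{k:(j,k)\in E}\tilde R^+_{j,k}/M\big)\pi_j$; (d) $\pi_{\mathrm{root}}=\sum_{i:(i,\mathrm{root})\in E}(\tilde R^+_{i,\mathrm{root}}/M)\pi_i+\sum_{j:\ell(j)=L+1}\sum_{i:(i,j)\in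 E}(\tilde R^+_{i,j}/M)\pi_i+\big(1-\sum_{j:(\mathrm{root},j)\in E}\tilde R^+_{\mathrm{root},j}/M\big)\pi_{\mathrm{root}}$; (e) if there is $j$ with $\pi_j>0$ and $\sum_{k:(j,k)\in E}\tilde R^+_{j,k}=0$, then $\sum_{k:(j,k)\in E}\tilde R^+_{j,k}=0$ for every $j$ with $\pi_j>0$. $(b,L,\mathbf C)$-colored-regret-matching: initialize $\tilde R^0_C=0$ for all $C\in\mathbf C$; at each time $t$ draw $a^t$ from some $\pi^t$ satisfying the requirement with parameter $L$ for the values $\tilde R_{i,j}:=\tilde R^{t-1}_{C}$, where $C$ is the color containing $(i,j)$; after choosing $a^t=i$ and observing $u^t$, set $\tilde R^t_C=\tilde R^{t-1}_C+\sum_{j:(i,j)\in C}(u^t(j)-u^t(i)-b)$ for all $C\in\mathbf C$. *)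

theory Defs
  imports "HOL-Probability.Probability" "HOL-Library.Extended_Nat"
begin

definition max_out_degree :: "'a set \<Rightarrow> ('a \<times> 'a) set \<Rightarrow> nat \<Rightarrow> bool" where
  "max_out_degree V E D \<longleftrightarrow>
     (\<forall>v\<in>V. finite (E `` {v}) \<and> card (E `` {v}) \<le> D) \<and> (\<exists>v\<in>V. card (E `` {v}) = D)"

(* (r, v) \<in> E ^^ n says that a directed path of n edges leads from r to v;
   the infimum of the empty set is \<infinity>. *)
definition level :: "('a \<times> 'a) set \<Rightarrow> 'a \<Rightarrow> 'a \<Rightarrow> enat" where
  "level E r v = (INF n\<in>{n. (r, v) \<in> E ^^ n}. enat n)"

definition edge_coloring :: "('a \<times> 'a) set \<Rightarrow> ('a \<times> 'a) set set \<Rightarrow> bool" where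
  "edge_coloring E Cs \<longleftrightarrow> partition_on E Cs \<and> countable Cs \<and>
     (\<forall>C\<in>Cs. \<forall>v x y. (v, x) \<in> C \<and> (v, y) \<in> C \<longrightarrow> x = y)"

definition color_of :: "('a \<times> 'a) set set \<Rightarrow> 'a \<times> 'a \<Rightarrow> ('a \<times> 'a) set" where
  "color_of Cs e = (THE C. C \<in> Cs \<and> e \<in> C)"

definition regret :: "(nat \<Rightarrow> 'a) \<Rightarrow> (nat \<Rightarrow> 'a \<Rightarrow> real) \<Rightarrow> nat \<Rightarrow> 'a \<Rightarrow> 'a \<Rightarrow> real" where
  "regret a u T x y = (\<Sum>t=1..T. if a t = x then u t y - u t x else 0)"

(* There may be infinitely many colors, and a color may contain infinitely many edges, but only
   finitely many terms of either sum are nonzero. The finite sum operator would return 0 on an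
   infinite index set. *)
definition local_color_regret ::
  "('a \<times> 'a) set set \<Rightarrow> (nat \<Rightarrow> 'a) \<Rightarrow> (nat \<Rightarrow> 'a \<Rightarrow> real) \<Rightarrow> nat \<Rightarrow> real" where
  "local_color_regret Cs a u T =
     (\<Sum>\<^sub>\<infinity>C\<in>Cs. max 0 (\<Sum>\<^sub>\<infinity>(i, j)\<in>C. regret a u T i j))"

(* The supremum is the maximum whenever the latter exists, as it does in the algorithm, where
   R takes finitely many values (if there are no edges, no ratio is ever used). A ratio with
   denominator 0 is 0. *)
definition regret_ratio ::
  "('a \<times> 'a) set \<Rightarrow> ('a \<Rightarrow> 'a \<Rightarrow> real) \<Rightarrow> 'a \<Rightarrow> 'a \<Rightarrow> real" where
  "regret_ratio E R i j = max 0 (R i j) / (SUP (x, y)\<in>E. max 0 (R x y))"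

(* Out-degrees are finite, but in-degrees need not be, so sums over in-neighbors are unordered
   infinite sums; by (b) they have finitely many nonzero terms. *)
definition stationary ::
  "'a set \<Rightarrow> ('a \<times> 'a) set \<Rightarrow> 'a \<Rightarrow> nat \<Rightarrow> ('a \<Rightarrow> 'a \<Rightarrow> real) \<Rightarrow> ('a \<Rightarrow> real) \<Rightarrow> bool" where
  "stationary V E r L R p \<longleftrightarrow>
     \<comment> \<open>(a)\<close>
     (p has_sum 1) V \<and> (\<forall>j\<in>V. p j \<ge> 0) \<and>
     \<comment> \<open>(b)\<close>
     (\<forall>j\<in>V. level E r j > enat L \<longrightarrow> p j = 0) \<and>
     \<comment> \<open>(c)\<close>
     (\<forall>j\<in>V. 1 \<le> level E r j \<and> level E r j \<le> enat L \<longrightarrow>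
        p j = (\<Sum>\<^sub>\<infinity>i\<in>{i. (i, j) \<in> E}. regret_ratio E R i j * p i)
              + (1 - (\<Sum>k\<in>E `` {j}. regret_ratio E R j k)) * p j) \<and>
     \<comment> \<open>(d)\<close>
     p r = (\<Sum>\<^sub>\<infinity>i\<in>{i. (i, r) \<in> E}. regret_ratio E R i r * p i)
           + (\<Sum>\<^sub>\<infinity>j\<in>{j\<in>V. level E r j = enat (L + 1)}.
                \<Sum>\<^sub>\<infinity>i\<in>{i. (i, j) \<in> E}. regret_ratio E R i j * p i)
           + (1 - (\<Sum>j\<in>E `` {r}. regret_ratio E R r j)) * p r \<and>
     \<comment> \<open>(e)\<close>
     ((\<exists>j\<in>V. p j > 0 \<and> (\<Sum>k\<in>E `` {j}. max 0 (R j k)) = 0) \<longrightarrow>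
        (\<forall>j\<in>V. p j > 0 \<longrightarrow> (\<Sum>k\<in>E `` {j}. max 0 (R j k)) = 0))"

primrec approx_regret ::
  "real \<Rightarrow> (nat \<Rightarrow> 'a) \<Rightarrow> (nat \<Rightarrow> 'a \<Rightarrow> real) \<Rightarrow> nat \<Rightarrow> ('a \<times> 'a) set \<Rightarrow> real" where
  "approx_regret b a u 0 C = 0"
| "approx_regret b a u (Suc t) C = approx_regret b a u t C
     + (\<Sum>j\<in>C `` {a (Suc t)}. u (Suc t) j - u (Suc t) (a (Suc t)) - b)"

(* The condition on one trajectory of play; that a t is drawn from p t is part of the
   locale online_play below. *)
definition colored_regret_matching ::
  "'a set \<Rightarrow> ('a \<times> 'a) set \<Rightarrow> 'a \<Rightarrow> real \<Rightarrow> nat \<Rightarrow> ('a \<times> 'a) set set \<Rightarrow>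
   (nat \<Rightarrow> 'a) \<Rightarrow> (nat \<Rightarrow> 'a \<Rightarrow> real) \<Rightarrow> (nat \<Rightarrow> 'a \<Rightarrow> real) \<Rightarrow> bool" where
  "colored_regret_matching V E r b L Cs a u p \<longleftrightarrow>
     (\<forall>t\<ge>1. stationary V E r L (\<lambda>i j. approx_regret b a u (t - 1) (color_of Cs (i, j))) (p t))"

(* The sigma-algebra generated by the actions at the times in A and the utility functions
   (through their evaluations at the points of V) at the times in U. *)
definition history ::
  "'w measure \<Rightarrow> 'a set \<Rightarrow> (nat \<Rightarrow> 'w \<Rightarrow> 'a) \<Rightarrow> (nat \<Rightarrow> 'w \<Rightarrow> 'a \<Rightarrow> real) \<Rightarrow>
   nat set \<Rightarrow> nat set \<Rightarrow> 'w measure" where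
  "history M V a u A U = sigma (space M)
     ({a s -` S \<inter> space M | s S. s \<in> A \<and> S \<subseteq> V} \<union>
      {(\<lambda>\<omega>. u s \<omega> v) -` B \<inter> space M | s v B. s \<in> U \<and> v \<in> V \<and> B \<in> sets borel})"

(* Times start at 1. The utility functions are arbitrary random functions. The distribution p t
   is a function of the past, and it is the conditional law of a t given the past and u t. *)
locale online_play = prob_space M
  for M :: "'w measure" and V :: "'a set"
    and a :: "nat \<Rightarrow> 'w \<Rightarrow> 'a" and u p :: "nat \<Rightarrow> 'w \<Rightarrow> 'a \<Rightarrow> real" +
  assumes action_measurable: "t \<ge> 1 \<Longrightarrow> a t \<in> measurable M (count_space V)"
    and utility_measurable: "t \<ge> 1 \<Longrightarrow> v \<in> V \<Longrightarrow> (\<lambda>\<omega>. u t \<omega> v) \<in> borel_measurable M"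
    and policy_from_past: "t \<ge> 1 \<Longrightarrow> v \<in> V \<Longrightarrow>
      (\<lambda>\<omega>. p t \<omega> v) \<in> borel_measurable (history M V a u {1..<t} {1..<t})"
    and action_drawn: "t \<ge> 1 \<Longrightarrow> v \<in> V \<Longrightarrow>
      AE \<omega> in M. real_cond_exp M (history M V a u {1..<t} {1..t})
                   (indicator {\<omega> \<in> space M. a t \<omega> = v}) \<omega> = p t \<omega> v"

end

theory Submission
  imports Defs
begin

text \<open>
  Write b = Delta / (L + 1). In a round the policy p sends the flow p i * ratio i j along the edge
  (i, j). By stationarity the flow is conserved at the vertices of level at most L, except that
  what reaches level L + 1 re-emerges at the root. Each unit of flow thus climbs L + 1 levels before
  returning, and the penalty b per edge pays for the utility difference Delta that it can gain.
  Hence the approximate regrets R have nonpositive drift in the direction of their positive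
  parts R^+.

  The increments of R lie in [-Delta - b, Delta - b], so the squares of R^+ could grow by
  (Delta + b)^2. The potential (R^+ + b)^2 absorbs the asymmetry: beyond the drift term, it
  grows by at most Delta^2 per active color. At most D colors are active in a round, and only the colors in C_L are ever
  active, so Cauchy--Schwarz bounds the expected sum of the R^+. Each active color adds b when
  passing from approximate to actual regret, which accounts for the term b D.
\<close>

section \<open>Closed form of the approximate regret, and the potential of a single color\<close>

lemma approx_regret_eq_sum:
  "approx_regret b a u t C = (\<Sum>s=1..t. \<Sum>j\<in>C `` {a s}. u s j - u s (a s) - b)"
  by (induction t) simp_all

text \<open>The shift by \<open>b\<close> cancels the penalty. If the new positive part is not
  clipped, the shifted value is \<open>x + d\<close>, so the second-order error is
  \<open>d\<^sup>2\<close> and not \<open>(d - b)\<^sup>2\<close>. If it is clipped, only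
  \<open>b\<^sup>2\<close> remains on the left, and since \<open>d\<close> is at least
  \<open>-\<Delta>\<close> the other terms on the right dominate
  \<open>(X - \<Delta>)\<^sup>2\<close> with \<open>X = max 0 x\<close>.\<close>

lemma potential_step:
  fixes x d b \<Delta> :: real
  assumes "b \<ge> 0" "\<bar>d\<bar> \<le> \<Delta>"
  shows "(max 0 (x + (d - b)) + b)\<^sup>2 \<le> (max 0 x + b)\<^sup>2 + 2 * max 0 x * (d - b) + \<Delta>\<^sup>2"
proof -
  define X where "X = max 0 x"
  have X: "X \<ge> 0" "X \<ge> x" by (auto simp: X_def)
  have rhs: "(X + b)\<^sup>2 + 2 * X * (d - b) + \<Delta>\<^sup>2 = X\<^sup>2 + 2 * X * d + b\<^sup>2 + \<Delta>\<^sup>2"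
    by (simp add: power2_eq_square algebra_simps)
  show ?thesis
  proof (cases "x + (d - b) \<le> 0")
    case True
    have "X * (d + \<Delta>) \<ge> 0" using assms X by (intro mult_nonneg_nonneg) auto
    moreover have "(X - \<Delta>)\<^sup>2 \<ge> 0" by simp
    moreover have "(X - \<Delta>)\<^sup>2 = X\<^sup>2 - 2 * X * \<Delta> + \<Delta>\<^sup>2"
      by (simp add: power2_diff)
    ultimately have "0 \<le> X\<^sup>2 + 2 * X * d + \<Delta>\<^sup>2" by (simp add: algebra_simps)
    thus ?thesis
      unfolding X_def[symmetric] rhs using True by (simp add: max_absorb1)
  next
    case False
    have "(x + d)\<^sup>2 \<le> (X + d)\<^sup>2" using False assms X by (intro power_mono) auto
    moreover have "d\<^sup>2 \<le> \<Delta>\<^sup>2"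
      using assms by (metis abs_le_square_iff abs_of_nonneg abs_ge_zero order_trans)
    moreover have "b\<^sup>2 \<ge> 0" by simp
    moreover have "max 0 (x + (d - b)) + b = x + d" using False by simp
    ultimately show ?thesis
      unfolding X_def[symmetric] rhs by (simp only: power2_sum)
  qed
qed

section \<open>Levels, near vertices and colors of the rooted graph\<close>

locale colored_rooted_graph =
  fixes V :: "'a set" and E :: "('a \<times> 'a) set" and root :: 'a and D L :: nat
    and Cs :: "('a \<times> 'a) set set"
  assumes edges: "E \<subseteq> V \<times> V"
    and out_degree: "max_out_degree V E D"
    and root_in_V: "root \<in> V"
    and coloring: "edge_coloring E Cs"
begin

text \<open>By (b) of stationarity the policy is supported here. The set is finite even if
  \<open>V\<close> is infinite, because out-degrees are finite, and this turns the infinite sums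
  below into finite ones.\<close>

definition near :: "'a set" where
  "near = {v. level E root v \<le> enat L}"

definition near_colors :: "('a \<times> 'a) set set" where
  "near_colors = {C \<in> Cs. \<exists>(i, j)\<in>C. level E root i \<le> enat L}"

lemma finite_successors: "v \<in> V \<Longrightarrow> finite (E `` {v})"
  using out_degree by (auto simp: max_out_degree_def)

lemma card_successors_le: "v \<in> V \<Longrightarrow> card (E `` {v}) \<le> D"
  using out_degree by (auto simp: max_out_degree_def)

lemma level_leI: "(root, v) \<in> E ^^ n \<Longrightarrow> level E root v \<le> enat n"
  by (auto simp: level_def intro!: INF_lower2[of n])

text \<open>A nonempty set in \<open>enat\<close> attains its infimum, and the empty set is excluded
  because its infimum is infinite.\<close>

lemma path_of_level:
  assumes "level E root v = enat n"
  shows "(root, v) \<in> E ^^ n"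
proof -
  let ?A = "enat ` {n. (root, v) \<in> E ^^ n}"
  have "?A \<noteq> {}"
  proof
    assume "?A = {}"
    hence "level E root v = \<infinity>"
      unfolding level_def by (metis Inf_empty top_enat_def)
    with assms show False by simp
  qed
  hence "Inf ?A \<in> ?A"
    by (metis (no_types, lifting) Inf_enat_def LeastI equals0I)
  with assms show ?thesis
    by (auto simp: level_def)
qed

lemma level_root: "level E root root = 0"
  using level_leI[of root 0] by (simp add: zero_enat_def[symmetric])

lemma level_eq_0_iff: "level E root v = 0 \<longleftrightarrow> v = root"
  using path_of_level[of v 0] by (auto simp: level_root zero_enat_def[symmetric])

lemma level_step:
  assumes "(i, j) \<in> E" "level E root i = enat n"
  shows "level E root j \<le> enat (Suc n)"
  using path_of_level[OF assms(2)] assms(1) by (intro level_leI) auto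

lemma finite_path_ends: "finite ((E ^^ n) `` {root}) \<and> (E ^^ n) `` {root} \<subseteq> V"
proof (induction n)
  case 0
  then show ?case using root_in_V by simp
next
  case (Suc n)
  have eq: "(E ^^ Suc n) `` {root} = (\<Union>v\<in>(E ^^ n) `` {root}. E `` {v})"
    by auto
  show ?case
    unfolding eq using Suc finite_successors edges by blast
qed

lemma level_le_enat_subset: "{v. level E root v \<le> enat n} \<subseteq> (\<Union>k\<le>n. (E ^^ k) `` {root})"
proof
  fix v assume "v \<in> {v. level E root v \<le> enat n}"
  then obtain k where "level E root v = enat k" "k \<le> n"
    by (cases "level E root v") auto
  thus "v \<in> (\<Union>k\<le>n. (E ^^ k) `` {root})"
    using path_of_level by blast
qed

lemma finite_level_le: "finite {v. level E root v \<le> enat n}"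
  by (rule finite_subset[OF level_le_enat_subset]) (use finite_path_ends in auto)

lemma level_le_in_V: "level E root v \<le> enat n \<Longrightarrow> v \<in> V"
  using level_le_enat_subset[of n] finite_path_ends by blast

lemma finite_near: "finite near"
  using finite_level_le by (simp add: near_def)

lemma near_subset: "near \<subseteq> V"
  using level_le_in_V by (auto simp: near_def)

lemma root_near: "root \<in> near"
  by (simp add: near_def level_root)

lemma color_unique: "C \<in> Cs \<Longrightarrow> C' \<in> Cs \<Longrightarrow> e \<in> C \<Longrightarrow> e \<in> C' \<Longrightarrow> C = C'"
  using coloring by (auto simp: edge_coloring_def partition_on_def disjoint_def)

lemma color_subset: "C \<in> Cs \<Longrightarrow> C \<subseteq> E"
  using coloring by (auto simp: edge_coloring_def partition_on_def)

lemma color_of_eq: "C \<in> Cs \<Longrightarrow> e \<in> C \<Longrightarrow> color_of Cs e = C"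
  unfolding color_of_def using color_unique by (intro the_equality) blast+

lemma color_of_edge:
  assumes "e \<in> E"
  shows "color_of Cs e \<in> Cs" "e \<in> color_of Cs e"
proof -
  obtain C where "C \<in> Cs" "e \<in> C"
    using assms coloring by (auto simp: edge_coloring_def partition_on_def)
  thus "color_of Cs e \<in> Cs" "e \<in> color_of Cs e"
    using color_of_eq by simp_all
qed

text \<open>Properness of the coloring reduces each sum over a color at a fixed vertex to at most
  one term; the estimates for one round rest on this.\<close>

lemma color_successors:
  assumes "C \<in> Cs"
  shows "C `` {v} = {} \<or> (\<exists>j. (v, j) \<in> E \<and> C `` {v} = {j})"
proof (cases "C `` {v} = {}")
  case False
  then obtain j where "(v, j) \<in> C" by auto
  moreover have "x = j" if "(v, x) \<in> C" for x
    using that \<open>(v, j) \<in> C\<close> assms coloring by (auto simp: edge_coloring_def)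
  ultimately show ?thesis using color_subset[OF assms] by blast
qed simp

lemma finite_color_successors: "C \<in> Cs \<Longrightarrow> finite (C `` {v})"
  using color_successors[of C v] by auto

lemma color_of_near: "(v, j) \<in> E \<Longrightarrow> v \<in> near \<Longrightarrow> color_of Cs (v, j) \<in> near_colors"
  using color_of_edge[of "(v, j)"] by (auto simp: near_colors_def near_def)

text \<open>Every near color is the color of one of the finitely many edges that leave near
  vertices. Hence \<open>card near_colors\<close> in the bound is a true count and not the default 0
  of an infinite set.\<close>

lemma finite_near_colors: "finite near_colors"
proof (rule finite_surj)
  show "finite (Sigma near (\<lambda>v. E `` {v}))"
    using finite_near near_subset finite_successors by auto
  show "near_colors \<subseteq> color_of Cs ` Sigma near (\<lambda>v. E `` {v})"
  proof
    fix C assume "C \<in> near_colors"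
    then obtain i j where "C \<in> Cs" "(i, j) \<in> C" "i \<in> near"
      by (auto simp: near_colors_def near_def)
    thus "C \<in> color_of Cs ` Sigma near (\<lambda>v. E `` {v})"
      using color_of_eq[of C "(i, j)"] color_subset by (intro image_eqI[of _ _ "(i, j)"]) auto
  qed
qed

lemma near_colors_subset: "near_colors \<subseteq> Cs"
  by (auto simp: near_colors_def)

text \<open>Each edge has exactly one color, and the color of an edge leaving a near vertex is near.
  So the pairs of a near color and one of its edges at \<open>v\<close> correspond to the edges
  leaving \<open>v\<close>.\<close>

lemma sum_near_colors:
  fixes g :: "('a \<times> 'a) set \<Rightarrow> 'a \<Rightarrow> real"
  assumes v: "v \<in> near"
  shows "(\<Sum>C\<in>near_colors. \<Sum>j\<in>C `` {v}. g C j) = (\<Sum>j\<in>E `` {v}. g (color_of Cs (v, j)) j)"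
proof -
  have "(\<Sum>C\<in>near_colors. \<Sum>j\<in>C `` {v}. g C j)
        = (\<Sum>(C, j)\<in>Sigma near_colors (\<lambda>C. C `` {v}). g C j)"
    using finite_near_colors finite_color_successors near_colors_subset
    by (intro sum.Sigma) auto
  also have "\<dots> = (\<Sum>j\<in>E `` {v}. g (color_of Cs (v, j)) j)"
  proof (rule sum.reindex_bij_witness[of _ "\<lambda>j. (color_of Cs (v, j), j)" snd])
    fix x assume "x \<in> Sigma near_colors (\<lambda>C. C `` {v})"
    then obtain C j where x: "x = (C, j)" "C \<in> Cs" "(v, j) \<in> C"
      using near_colors_subset by auto
    thus "(color_of Cs (v, snd x), snd x) = x" "snd x \<in> E `` {v}"
      "g (color_of Cs (v, snd x)) (snd x) = (case x of (C, j) \<Rightarrow> g C j)"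
      using color_of_eq[of C "(v, j)"] color_subset[of C] by auto
  qed (use v color_of_near color_of_edge in auto)
  finally show ?thesis .
qed

lemma sum_card_near_colors:
  assumes "v \<in> near"
  shows "(\<Sum>C\<in>near_colors. real (card (C `` {v}))) \<le> real D"
proof -
  have "(\<Sum>C\<in>near_colors. real (card (C `` {v}))) = real (card (E `` {v}))"
    using sum_near_colors[OF assms, of "\<lambda>_ _. 1"] by simp
  thus ?thesis
    using card_successors_le[of v] assms near_subset by auto
qed

section \<open>Deterministic estimates for a round and for a trajectory\<close>

text \<open>Summed by parts, the flow leaves only the inflow of the vertices of level
  \<open>L + 1\<close>, which (d) hands to the root; on it the penalties collected along a climb
  offset \<open>\<Delta>\<close>. The hypothesis \<open>bdd\<close> makes the supremum in
  \<open>regret_ratio\<close> an upper bound for every edge.\<close>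

lemma stationary_drift_nonpos:
  fixes R :: "'a \<Rightarrow> 'a \<Rightarrow> real" and p u :: "'a \<Rightarrow> real"
  assumes stat: "stationary V E root L R p"
    and bdd: "bdd_above ((\<lambda>(x, y). max 0 (R x y)) ` E)"
    and u: "\<And>x y. x \<in> V \<Longrightarrow> y \<in> V \<Longrightarrow> \<bar>u x - u y\<bar> \<le> \<Delta>"
  shows "(\<Sum>i\<in>near. \<Sum>j\<in>E `` {i}. p i * max 0 (R i j) * (u j - u i - \<Delta> / (real L + 1))) \<le> 0"
proof -
  define m where "m = (SUP (x, y)\<in>E. max 0 (R x y))"
  define \<rho> where "\<rho> = regret_ratio E R"
  define b where "b = \<Delta> / (real L + 1)"
  have \<Delta>: "\<Delta> \<ge> 0" using u[OF root_in_V root_in_V] by simp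
  have b: "b \<ge> 0" "b * (real L + 1) = \<Delta>" using \<Delta> by (auto simp: b_def field_simps)
  have le_m: "max 0 (R i j) \<le> m" if "(i, j) \<in> E" for i j
    using cSUP_upper[OF that bdd] by (simp add: m_def)
  \<comment> \<open>This includes \<open>m = 0\<close>: the ratio is then 0 by division by zero, and
    the positive part vanishes because it is at most \<open>m\<close>.\<close>
  have m_ratio: "m * \<rho> i j = max 0 (R i j)" if "(i, j) \<in> E" for i j
    using le_m[OF that] by (auto simp: \<rho>_def regret_ratio_def m_def[symmetric])
  \<comment> \<open>The supremum of the empty set of reals carries no information about its sign, so
    the edgeless graph is treated separately at the end.\<close>
  have m_nonneg: "m \<ge> 0" if "E \<noteq> {}"
    using that le_m by (metis equals0I max.bounded_iff old.prod.exhaust)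
  have ratio_nonneg: "\<rho> i j \<ge> 0" if "(i, j) \<in> E" for i j
    using m_nonneg that unfolding \<rho>_def regret_ratio_def m_def[symmetric]
    by (intro divide_nonneg_nonneg) auto

  define Q where "Q = {j \<in> V. level E root j = enat (L + 1)}"
  define inflow where "inflow j = (\<Sum>i | i \<in> near \<and> (i, j) \<in> E. \<rho> i j * p i)" for j
  define outflow where "outflow i = (\<Sum>j\<in>E `` {i}. \<rho> i j * p i)" for i
  \<comment> \<open>The level rises by at most 1 along an edge, so u j - u i - b is at most w j - w i; the sum of
    the flow against the differences of w telescopes by conservation.\<close>
  define w where "w j = u j - b * real (the_enat (level E root j))" for j
  have fin_Q: "finite Q"
    by (rule finite_subset[OF _ finite_level_le[of "L + 1"]]) (auto simp: Q_def)
  have disj: "near \<inter> Q = {}" by (auto simp: near_def Q_def)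
  have p_nonneg: "p j \<ge> 0" if "j \<in> V" for j using stat that by (auto simp: stationary_def)
  have p_far: "p i = 0" if "i \<in> V" "i \<notin> near" for i
    using stat that by (auto simp: stationary_def near_def not_le)
  \<comment> \<open>In-degrees may be infinite, but by (b) only near in-neighbors carry
    mass.\<close>
  have inflow_eq: "(\<Sum>\<^sub>\<infinity>i\<in>{i. (i, j) \<in> E}. \<rho> i j * p i) = inflow j" for j
  proof -
    have "(\<Sum>\<^sub>\<infinity>i\<in>{i. (i, j) \<in> E}. \<rho> i j * p i) = (\<Sum>\<^sub>\<infinity>i\<in>{i. i \<in> near \<and> (i, j) \<in> E}. \<rho> i j * p i)"
      using p_far edges by (intro infsum_cong_neutral) auto
    also have "\<dots> = inflow j" unfolding inflow_def using finite_near by simp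
    finally show ?thesis .
  qed
  have inflow_nonneg: "inflow j \<ge> 0" for j
    unfolding inflow_def using ratio_nonneg p_nonneg near_subset by (intro sum_nonneg) auto
  \<comment> \<open>Condition (c) applies at every near vertex other than the root, and
    \<open>p j\<close> cancels from its two sides.\<close>
  have conserve: "inflow j = outflow j" if "j \<in> near" "j \<noteq> root" for j
  proof -
    have "1 \<le> level E root j"
      using that level_eq_0_iff[of j] by (metis ileI1 one_eSuc zero_less_iff_neq_zero)
    hence "p j = inflow j + (1 - (\<Sum>k\<in>E `` {j}. \<rho> j k)) * p j"
      using stat that near_subset unfolding stationary_def inflow_eq[symmetric] \<rho>_def
      by (auto simp: near_def)
    thus ?thesis by (simp add: outflow_def algebra_simps sum_distrib_left sum_distrib_right)
  qed
  have conserve_root: "outflow root = inflow root + (\<Sum>j\<in>Q. inflow j)"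
  proof -
    have "p root = inflow root + (\<Sum>\<^sub>\<infinity>j\<in>Q. inflow j)
        + (1 - (\<Sum>k\<in>E `` {root}. \<rho> root k)) * p root"
      using stat unfolding stationary_def inflow_eq[symmetric] \<rho>_def Q_def by blast
    thus ?thesis using fin_Q
      by (simp add: outflow_def algebra_simps sum_distrib_left sum_distrib_right)
  qed
  \<comment> \<open>Flow leaving \<open>near\<close> cannot skip level \<open>L + 1\<close>, so
    \<open>near\<close> and \<open>Q\<close> together contain every head when the sum is regrouped
    by heads.\<close>
  have target: "j \<in> near \<union> Q" if "(i, j) \<in> E" "i \<in> near" for i j
  proof -
    from that obtain n where n: "level E root i = enat n" "n \<le> L"
      by (cases "level E root i") (auto simp: near_def)
    have "level E root j \<le> enat (Suc L)"
      using level_step[OF that(1) n(1)] n(2) by (meson enat_ord_simps(1) not_less_eq_eq order_trans)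
    thus ?thesis using that edges
      by (cases "level E root j") (auto simp: near_def Q_def le_Suc_eq)
  qed

  have "(\<Sum>i\<in>near. \<Sum>j\<in>E `` {i}. \<rho> i j * p i * w j)
      = (\<Sum>(i, j)\<in>Sigma near (\<lambda>i. E `` {i}). \<rho> i j * p i * w j)"
    using finite_near finite_successors near_subset by (intro sum.Sigma) auto
  also have "\<dots> = (\<Sum>(j, i)\<in>Sigma (near \<union> Q) (\<lambda>j. {i \<in> near. (i, j) \<in> E}). \<rho> i j * p i * w j)"
    by (rule sum.reindex_bij_witness[of _ prod.swap prod.swap]) (use target in auto)
  also have "\<dots> = (\<Sum>j\<in>near \<union> Q. \<Sum>i | i \<in> near \<and> (i, j) \<in> E. \<rho> i j * p i * w j)"
    using finite_near fin_Q by (intro sum.Sigma[symmetric]) auto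
  also have "\<dots> = (\<Sum>j\<in>near \<union> Q. w j * inflow j)"
    by (simp add: inflow_def sum_distrib_left mult.commute)
  also have "\<dots> = (\<Sum>j\<in>near. w j * inflow j) + (\<Sum>j\<in>Q. w j * inflow j)"
    using finite_near fin_Q disj by (intro sum.union_disjoint)
  finally have arrive: "(\<Sum>i\<in>near. \<Sum>j\<in>E `` {i}. \<rho> i j * p i * w j)
      = (\<Sum>j\<in>near. w j * inflow j) + (\<Sum>j\<in>Q. w j * inflow j)" .
  have depart: "(\<Sum>i\<in>near. \<Sum>j\<in>E `` {i}. \<rho> i j * p i * w i) = (\<Sum>i\<in>near. w i * outflow i)"
    by (simp add: outflow_def sum_distrib_left mult.commute)
  \<comment> \<open>Conservation removes all terms except that of the root, whose outflow exceeds
    its inflow by the total inflow of \<open>Q\<close>.\<close>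
  have "(\<Sum>j\<in>near. w j * (inflow j - outflow j)) = (\<Sum>j\<in>{root}. w j * (inflow j - outflow j))"
    using finite_near root_near conserve by (intro sum.mono_neutral_right) auto
  also have "\<dots> = - (\<Sum>j\<in>Q. w root * inflow j)"
    using conserve_root by (simp add: sum_distrib_left[symmetric] right_diff_distrib distrib_left)
  finally have "(\<Sum>i\<in>near. \<Sum>j\<in>E `` {i}. \<rho> i j * p i * (w j - w i))
      = (\<Sum>j\<in>Q. (w j - w root) * inflow j)"
    using arrive depart by (simp add: sum_subtractf algebra_simps)
  also have "\<dots> \<le> 0"
  proof (rule sum_nonpos)
    fix j assume "j \<in> Q"
    \<comment> \<open>The value of \<open>b\<close> is chosen for this: level \<open>L + 1\<close>
      costs \<open>(L + 1) * b = \<Delta>\<close>.\<close>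
    hence "w j - w root = u j - u root - \<Delta>"
      using b(2) by (simp add: w_def Q_def level_root zero_enat_def algebra_simps)
    also have "\<dots> \<le> 0"
      using u[of j root] \<open>j \<in> Q\<close> root_in_V by (auto simp: Q_def)
    finally show "(w j - w root) * inflow j \<le> 0"
      using inflow_nonneg by (simp add: mult_nonpos_nonneg)
  qed
  finally have flow: "(\<Sum>i\<in>near. \<Sum>j\<in>E `` {i}. \<rho> i j * p i * (w j - w i)) \<le> 0" .

  have step: "u j - u i - b \<le> w j - w i" if "i \<in> near" "(i, j) \<in> E" for i j
  proof -
    from that obtain n where n: "level E root i = enat n"
      by (cases "level E root i") (auto simp: near_def)
    from level_step[OF that(2) n] obtain k where k: "level E root j = enat k" "k \<le> Suc n"
      by (cases "level E root j") auto
    have "b * real k \<le> b * (real n + 1)" using k(2) b(1) by (intro mult_left_mono) auto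
    thus ?thesis by (simp add: w_def n k algebra_simps)
  qed
  have "(\<Sum>i\<in>near. \<Sum>j\<in>E `` {i}. p i * max 0 (R i j) * (u j - u i - b))
      = (\<Sum>i\<in>near. \<Sum>j\<in>E `` {i}. m * (\<rho> i j * p i * (u j - u i - b)))"
    by (intro sum.cong refl) (simp add: m_ratio[symmetric])
  also have "\<dots> \<le> (\<Sum>i\<in>near. \<Sum>j\<in>E `` {i}. m * (\<rho> i j * p i * (w j - w i)))"
    using step p_nonneg ratio_nonneg near_subset m_nonneg
    by (intro sum_mono mult_left_mono mult_nonneg_nonneg) auto
  also have "\<dots> = m * (\<Sum>i\<in>near. \<Sum>j\<in>E `` {i}. \<rho> i j * p i * (w j - w i))"
    by (simp add: sum_distrib_left)
  also have "\<dots> \<le> 0"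
  proof (cases "E = {}")
    case False
    thus ?thesis using m_nonneg flow by (simp add: mult_nonneg_nonpos)
  qed simp
  finally show ?thesis by (simp add: b_def)
qed

text \<open>Actions stay in \<open>near\<close>, so edges starting elsewhere have regret 0 and both
  infinite sums become finite. Undoing the penalty then costs \<open>b\<close> per active color and
  round, with at most \<open>D\<close> active colors in a round.\<close>

lemma local_color_regret_le:
  fixes a :: "nat \<Rightarrow> 'a" and u :: "nat \<Rightarrow> 'a \<Rightarrow> real"
  assumes a: "\<And>t. t \<in> {1..T} \<Longrightarrow> a t \<in> near" and b: "b \<ge> 0"
  shows "local_color_regret Cs a u T
    \<le> (\<Sum>C\<in>near_colors. max 0 (approx_regret b a u T C)) + b * real D * real T"
proof -
  have inner: "(\<Sum>\<^sub>\<infinity>(i, j)\<in>C. regret a u T i j) = (\<Sum>t=1..T. \<Sum>j\<in>C `` {a t}. u t j - u t (a t))"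
    if C: "C \<in> Cs" for C
  proof -
    let ?S = "Sigma near (\<lambda>i. C `` {i})"
    have "(\<Sum>\<^sub>\<infinity>(i, j)\<in>C. regret a u T i j) = (\<Sum>\<^sub>\<infinity>(i, j)\<in>?S. regret a u T i j)"
    proof (rule infsum_cong_neutral)
      fix x assume "x \<in> C - ?S"
      then obtain i j where "x = (i, j)" "i \<notin> near" by (cases x) auto
      thus "(case x of (i, j) \<Rightarrow> regret a u T i j) = 0"
        using a unfolding regret_def by (auto intro!: sum.neutral)
    qed auto
    also have "\<dots> = (\<Sum>(i, j)\<in>?S. regret a u T i j)"
      using finite_near finite_color_successors[OF C] by (intro infsum_finite) auto
    also have "\<dots> = (\<Sum>i\<in>near. \<Sum>j\<in>C `` {i}. regret a u T i j)"
      using finite_near finite_color_successors[OF C] by (intro sum.Sigma[symmetric]) auto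
    also have "\<dots> = (\<Sum>i\<in>near. \<Sum>t=1..T. \<Sum>j\<in>C `` {i}. if a t = i then u t j - u t i else 0)"
      unfolding regret_def by (intro sum.cong refl sum.swap)
    also have "\<dots> = (\<Sum>t=1..T. \<Sum>i\<in>near. \<Sum>j\<in>C `` {i}. if a t = i then u t j - u t i else 0)"
      by (rule sum.swap)
    also have "\<dots> = (\<Sum>t=1..T. \<Sum>i\<in>near. if a t = i then \<Sum>j\<in>C `` {i}. u t j - u t i else 0)"
      by (intro sum.cong refl) auto
    also have "\<dots> = (\<Sum>t=1..T. \<Sum>j\<in>C `` {a t}. u t j - u t (a t))"
      using a finite_near by (intro sum.cong[OF refl]) simp
    finally show ?thesis .
  qed
  have "local_color_regret Cs a u T
      = (\<Sum>\<^sub>\<infinity>C\<in>near_colors. max 0 (\<Sum>\<^sub>\<infinity>(i, j)\<in>C. regret a u T i j))"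
    unfolding local_color_regret_def
  proof (rule infsum_cong_neutral)
    fix C assume "C \<in> Cs - near_colors"
    hence "C `` {a t} = {}" if "t \<in> {1..T}" for t
      using a[OF that] by (auto simp: near_colors_def near_def)
    moreover have "C \<in> Cs" using \<open>C \<in> Cs - near_colors\<close> by simp
    ultimately show "max 0 (\<Sum>\<^sub>\<infinity>(i, j)\<in>C. regret a u T i j) = 0"
      by (simp add: inner)
  qed (use near_colors_subset in auto)
  also have "\<dots> = (\<Sum>C\<in>near_colors. max 0 (\<Sum>t=1..T. \<Sum>j\<in>C `` {a t}. u t j - u t (a t)))"
    using finite_near_colors near_colors_subset inner by (auto intro!: sum.cong)
  also have "\<dots> = (\<Sum>C\<in>near_colors. max 0 (approx_regret b a u T C
                      + b * (\<Sum>t=1..T. real (card (C `` {a t})))))"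
    by (simp add: approx_regret_eq_sum sum.distrib[symmetric] sum_distrib_left sum_subtractf mult.commute)
  also have "\<dots> \<le> (\<Sum>C\<in>near_colors. max 0 (approx_regret b a u T C)
                      + b * (\<Sum>t=1..T. real (card (C `` {a t}))))"
  proof (rule sum_mono)
    fix C :: "('a \<times> 'a) set"
    have "b * (\<Sum>t=1..T. real (card (C `` {a t}))) \<ge> 0"
      using b by (intro mult_nonneg_nonneg sum_nonneg) auto
    thus "max 0 (approx_regret b a u T C + b * (\<Sum>t=1..T. real (card (C `` {a t}))))
        \<le> max 0 (approx_regret b a u T C) + b * (\<Sum>t=1..T. real (card (C `` {a t})))"
      by linarith
  qed
  also have "\<dots> = (\<Sum>C\<in>near_colors. max 0 (approx_regret b a u T C))
      + b * (\<Sum>t=1..T. \<Sum>C\<in>near_colors. real (card (C `` {a t})))"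
    by (simp only: sum.distrib sum_distrib_left sum.swap[of _ near_colors "{1..T}"])
  also have "(\<Sum>t=1..T. \<Sum>C\<in>near_colors. real (card (C `` {a t}))) \<le> (\<Sum>t=1..T. real D)"
    using a by (intro sum_mono sum_card_near_colors)
  hence "b * (\<Sum>t=1..T. \<Sum>C\<in>near_colors. real (card (C `` {a t}))) \<le> b * real D * real T"
    using b mult_left_mono by (fastforce simp: algebra_simps)
  finally show ?thesis by simp
qed

text \<open>A crude bound, used for integrability and for boundedness of the positive parts in
  \<open>regret_ratio\<close>. A round changes the value of a color by at most
  \<open>\<Delta> + b\<close>, since at most one of its edges leaves the action.\<close>

lemma abs_approx_regret_le:
  assumes C: "C \<in> Cs" and a: "\<And>s. s \<ge> 1 \<Longrightarrow> a s \<in> V"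
    and u: "\<And>s x y. s \<ge> 1 \<Longrightarrow> x \<in> V \<Longrightarrow> y \<in> V \<Longrightarrow> \<bar>u s x - u s y\<bar> \<le> \<Delta>"
    and b: "b \<ge> 0"
  shows "\<bar>approx_regret b a u t C\<bar> \<le> real t * (\<Delta> + b)"
proof (induction t)
  case (Suc t)
  have "\<Delta> \<ge> 0" using u[OF _ root_in_V root_in_V, of 1] by simp
  moreover have "\<bar>u (Suc t) j - u (Suc t) (a (Suc t))\<bar> \<le> \<Delta>" if "(a (Suc t), j) \<in> E" for j
    using that edges a[of "Suc t"] by (intro u) auto
  ultimately have "\<bar>\<Sum>j\<in>C `` {a (Suc t)}. u (Suc t) j - u (Suc t) (a (Suc t)) - b\<bar> \<le> \<Delta> + b"
    using color_successors[OF C, of "a (Suc t)"] b by fastforce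
  thus ?case using Suc by (simp add: algebra_simps)
qed simp

text \<open>\<open>potential_step\<close> is applied to the active colors alone, and the others do
  not change. The error is therefore counted \<open>D\<close> times instead of once for each near
  color.\<close>

lemma potential_increment:
  fixes u :: "'a \<Rightarrow> real" and X :: "('a \<times> 'a) set \<Rightarrow> real"
  assumes v: "v \<in> near" and b: "b \<ge> 0"
    and u: "\<And>x y. x \<in> V \<Longrightarrow> y \<in> V \<Longrightarrow> \<bar>u x - u y\<bar> \<le> \<Delta>"
  shows "(\<Sum>C\<in>near_colors. (max 0 (X C + (\<Sum>j\<in>C `` {v}. u j - u v - b)) + b)\<^sup>2)
    \<le> (\<Sum>C\<in>near_colors. (max 0 (X C) + b)\<^sup>2)
      + 2 * (\<Sum>C\<in>near_colors. max 0 (X C) * (\<Sum>j\<in>C `` {v}. u j - u v - b)) + real D * \<Delta>\<^sup>2"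
proof -
  have "(\<Sum>C\<in>near_colors. (max 0 (X C + (\<Sum>j\<in>C `` {v}. u j - u v - b)) + b)\<^sup>2)
    \<le> (\<Sum>C\<in>near_colors. (max 0 (X C) + b)\<^sup>2 + 2 * (max 0 (X C) * (\<Sum>j\<in>C `` {v}. u j - u v - b))
         + real (card (C `` {v})) * \<Delta>\<^sup>2)"
  proof (rule sum_mono)
    fix C assume "C \<in> near_colors"
    hence C: "C \<in> Cs" using near_colors_subset by auto
    from color_successors[OF C, of v] consider "C `` {v} = {}"
      | j where "(v, j) \<in> E" "C `` {v} = {j}" by blast
    thus "(max 0 (X C + (\<Sum>j\<in>C `` {v}. u j - u v - b)) + b)\<^sup>2
      \<le> (max 0 (X C) + b)\<^sup>2 + 2 * (max 0 (X C) * (\<Sum>j\<in>C `` {v}. u j - u v - b))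
         + real (card (C `` {v})) * \<Delta>\<^sup>2"
    proof cases
      case 2
      hence "\<bar>u j - u v\<bar> \<le> \<Delta>" using u edges by blast
      from potential_step[OF b this, of "X C"] show ?thesis by (simp add: 2)
    qed simp
  qed
  also have "\<dots> = (\<Sum>C\<in>near_colors. (max 0 (X C) + b)\<^sup>2)
      + 2 * (\<Sum>C\<in>near_colors. max 0 (X C) * (\<Sum>j\<in>C `` {v}. u j - u v - b))
      + (\<Sum>C\<in>near_colors. real (card (C `` {v}))) * \<Delta>\<^sup>2"
    by (simp add: sum.distrib sum_distrib_left sum_distrib_right)
  finally show ?thesis
    using mult_right_mono[OF sum_card_near_colors[OF v], of "\<Delta>\<^sup>2"] by simp
qed

end

section \<open>Histories and the conditional law of the action\<close>

lemma (in online_play) action_in_V: "t \<ge> 1 \<Longrightarrow> \<omega> \<in> space M \<Longrightarrow> a t \<omega> \<in> V"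
  using measurable_space[OF action_measurable] by simp

lemma (in online_play) sets_history:
  assumes "\<And>s. s \<in> A \<union> U \<Longrightarrow> s \<ge> 1"
  shows "sets (history M V a u A U) \<subseteq> sets M"
proof -
  have "{a s -` S \<inter> space M | s S. s \<in> A \<and> S \<subseteq> V} \<union>
      {(\<lambda>\<omega>. u s \<omega> v) -` B \<inter> space M | s v B. s \<in> U \<and> v \<in> V \<and> B \<in> sets borel} \<subseteq> sets M"
    using assms by (auto intro!: measurable_sets[OF action_measurable] measurable_sets[OF utility_measurable])
  from sets.sigma_sets_subset[OF this] show ?thesis
    unfolding history_def by (subst sets_measure_of) auto
qed

lemma space_history: "space (history M V a u A U) = space M"
  unfolding history_def by (rule space_measure_of) auto

lemma (in online_play) finite_measure_subalgebra_history:
  assumes "\<And>s. s \<in> A \<union> U \<Longrightarrow> s \<ge> 1"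
  shows "finite_measure_subalgebra M (history M V a u A U)"
  using sets_history[OF assms]
  by unfold_locales (auto simp: subalgebra_def space_history)

lemma (in online_play) action_history_measurable:
  assumes "s \<ge> 1" "s \<in> A"
  shows "a s \<in> measurable (history M V a u A U) (count_space V)"
proof (rule measurableI)
  fix \<omega> assume "\<omega> \<in> space (history M V a u A U)"
  thus "a s \<omega> \<in> space (count_space V)"
    using action_in_V[OF assms(1)] by (simp add: space_history)
next
  fix S assume "S \<in> sets (count_space V)"
  thus "a s -` S \<inter> space (history M V a u A U) \<in> sets (history M V a u A U)"
    unfolding space_history using assms(2)
    unfolding history_def by (subst sets_measure_of) (auto intro!: sigma_sets.Basic)
qed

lemma (in online_play) utility_history_measurable:
  assumes "s \<in> U" "v \<in> V"
  shows "(\<lambda>\<omega>. u s \<omega> v) \<in> borel_measurable (history M V a u A U)"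
proof (rule measurableI)
  fix B :: "real set" assume "B \<in> sets borel"
  thus "(\<lambda>\<omega>. u s \<omega> v) -` B \<inter> space (history M V a u A U) \<in> sets (history M V a u A U)"
    unfolding space_history using assms
    unfolding history_def by (subst sets_measure_of) (auto intro!: sigma_sets.Basic)
qed simp

lemma (in online_play) policy_measurable:
  assumes "t \<ge> 1" "v \<in> V"
  shows "(\<lambda>\<omega>. p t \<omega> v) \<in> borel_measurable M"
  using measurable_from_subalg[OF finite_measure_subalgebra.subalg policy_from_past[OF assms]]
    finite_measure_subalgebra_history by auto

lemma (in online_play) action_event:
  assumes "t \<ge> 1" "v \<in> V"
  shows "{\<omega> \<in> space M. a t \<omega> = v} \<in> sets M"
  using measurable_sets[OF action_measurable[OF assms(1)], of "{v}"] assms(2)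
  by (simp add: vimage_def Int_def conj_commute)

text \<open>Here the conditional law enters: \<open>f\<close> is known before \<open>a t\<close> is
  drawn, so it can be moved inside the conditional expectation of the indicator, which is
  \<open>p t v\<close> almost surely.\<close>

lemma (in online_play) expectation_action:
  fixes f :: "'w \<Rightarrow> real"
  assumes t: "t \<ge> 1" and v: "v \<in> V"
    and f: "f \<in> borel_measurable (history M V a u {1..<t} {1..t})"
    and bounded: "\<And>\<omega>. \<omega> \<in> space M \<Longrightarrow> \<bar>f \<omega>\<bar> \<le> B"
  shows "integrable M (\<lambda>\<omega>. f \<omega> * indicator {\<omega> \<in> space M. a t \<omega> = v} \<omega>)"
    and "integrable M (\<lambda>\<omega>. f \<omega> * p t \<omega> v)"
    and "(\<integral>\<omega>. f \<omega> * indicator {\<omega> \<in> space M. a t \<omega> = v} \<omega> \<partial>M) = (\<integral>\<omega>. f \<omega> * p t \<omega> v \<partial>M)"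
proof -
  let ?F = "history M V a u {1..<t} {1..t}" and ?A = "{\<omega> \<in> space M. a t \<omega> = v}"
  interpret F: finite_measure_subalgebra M ?F
    by (rule finite_measure_subalgebra_history) auto
  have [measurable]: "?A \<in> sets M" using t v by (rule action_event)
  have [measurable]: "f \<in> borel_measurable M"
    using F.subalg f by (rule measurable_from_subalg)
  have [measurable]: "(\<lambda>\<omega>. p t \<omega> v) \<in> borel_measurable M" using t v by (rule policy_measurable)
  have "integrable M f"
    by (rule integrable_const_bound[of _ B]) (use bounded in auto)
  hence int: "integrable M (\<lambda>\<omega>. f \<omega> * indicator ?A \<omega>)"
    using integrable_mult_indicator[of ?A M f] by (simp add: mult.commute)
  thus "integrable M (\<lambda>\<omega>. f \<omega> * indicator ?A \<omega>)" .
  have AE: "AE \<omega> in M. f \<omega> * real_cond_exp M ?F (indicator ?A) \<omega> = f \<omega> * p t \<omega> v"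
    using action_drawn[OF t v] by auto
  have "(indicator ?A :: 'w \<Rightarrow> real) \<in> borel_measurable M" by measurable
  note intg = F.real_cond_exp_intg[OF int f this]
  \<comment> \<open>Integrability is inherited from the product with the conditional expectation,
    which agrees with this one almost surely.\<close>
  show "integrable M (\<lambda>\<omega>. f \<omega> * p t \<omega> v)"
    using intg(1) AE by (subst integrable_cong_AE[symmetric, OF _ _ AE]) auto
  show "(\<integral>\<omega>. f \<omega> * indicator ?A \<omega> \<partial>M) = (\<integral>\<omega>. f \<omega> * p t \<omega> v \<partial>M)"
    using intg(2) by (subst integral_cong_AE[symmetric, OF _ _ AE]) auto
qed

section \<open>The algorithm under random play\<close>

locale colored_play =
  colored_rooted_graph V E root D L Cs + online_play M V a u p
  for V :: "'a set" and E :: "('a \<times> 'a) set" and root :: 'a and D L :: nat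
    and Cs :: "('a \<times> 'a) set set" and M :: "'w measure"
    and a :: "nat \<Rightarrow> 'w \<Rightarrow> 'a" and u p :: "nat \<Rightarrow> 'w \<Rightarrow> 'a \<Rightarrow> real" +
  fixes \<Delta> :: real
  assumes utility_diff: "\<And>t \<omega> x y. t \<ge> 1 \<Longrightarrow> \<omega> \<in> space M \<Longrightarrow> x \<in> V \<Longrightarrow> y \<in> V \<Longrightarrow>
           \<bar>u t \<omega> x - u t \<omega> y\<bar> \<le> \<Delta>"
    and algorithm: "\<And>\<omega>. \<omega> \<in> space M \<Longrightarrow>
           colored_regret_matching V E root (\<Delta> / (real L + 1)) L Cs
             (\<lambda>t. a t \<omega>) (\<lambda>t. u t \<omega>) (\<lambda>t. p t \<omega>)"
begin

definition b :: real where
  "b = \<Delta> / (real L + 1)"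

text \<open>
  Almost surely equal to the action, but with values in a finite set: since V may be uncountable,
  a function of \<open>a t\<close> and \<open>u t\<close> need not be measurable on the null set where \<open>a t\<close> leaves
  \<open>near\<close>.
\<close>

definition near_action :: "nat \<Rightarrow> 'w \<Rightarrow> 'a" where
  "near_action t \<omega> = (if a t \<omega> \<in> near then a t \<omega> else root)"

text \<open>Built on \<open>near_action\<close> to be measurable; almost surely it equals the value
  kept by the algorithm, by \<open>R_eq\<close> and \<open>AE_actions_near\<close>.\<close>

definition R :: "nat \<Rightarrow> 'w \<Rightarrow> ('a \<times> 'a) set \<Rightarrow> real" where
  "R t \<omega> C = approx_regret b (\<lambda>s. near_action s \<omega>) (\<lambda>s. u s \<omega>) t C"

text \<open>The vertex is an explicit argument: for fixed \<open>v\<close> the gain depends on the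
  utility alone and so is known before the action is drawn.\<close>

definition gain :: "nat \<Rightarrow> 'w \<Rightarrow> ('a \<times> 'a) set \<Rightarrow> 'a \<Rightarrow> real" where
  "gain t \<omega> C v = (\<Sum>j\<in>C `` {v}. u t \<omega> j - u t \<omega> v - b)"

lemma R_Suc: "R (Suc t) \<omega> C = R t \<omega> C + gain (Suc t) \<omega> C (near_action (Suc t) \<omega>)"
  by (simp add: R_def gain_def)

lemma Delta_nonneg: "\<Delta> \<ge> 0"
proof -
  obtain \<omega> where "\<omega> \<in> space M" using not_empty by auto
  from utility_diff[OF _ this root_in_V root_in_V, of 1] show ?thesis by simp
qed

lemma b_nonneg: "b \<ge> 0"
  using Delta_nonneg by (simp add: b_def)

lemma near_action_near: "near_action t \<omega> \<in> near"
  using root_near by (simp add: near_action_def)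

lemma near_action_in_V: "near_action t \<omega> \<in> V"
  using near_action_near near_subset by blast

lemma stationary_policy:
  assumes "t \<ge> 1" "\<omega> \<in> space M"
  shows "stationary V E root L
    (\<lambda>i j. approx_regret b (\<lambda>s. a s \<omega>) (\<lambda>s. u s \<omega>) (t - 1) (color_of Cs (i, j))) (p t \<omega>)"
  using algorithm[OF assms(2)] assms(1) by (simp add: colored_regret_matching_def b_def)

lemma sum_policy_near:
  assumes "t \<ge> 1" "\<omega> \<in> space M"
  shows "(\<Sum>v\<in>near. p t \<omega> v) = 1"
proof -
  have "((\<lambda>v. p t \<omega> v) has_sum 1) V" and far: "\<And>v. v \<in> V \<Longrightarrow> v \<notin> near \<Longrightarrow> p t \<omega> v = 0"
    using stationary_policy[OF assms] by (auto simp: stationary_def near_def not_le)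
  hence "((\<lambda>v. p t \<omega> v) has_sum 1) near"
    using near_subset by (subst has_sum_cong_neutral[of V near _ "\<lambda>v. p t \<omega> v"]) auto
  thus ?thesis using finite_near by (simp add: has_sum_finite_iff)
qed

text \<open>The finitely many disjoint events \<open>a t \<omega> = v\<close> with \<open>v\<close>
  near have as probabilities the expectations of \<open>p t \<omega> v\<close>, and these add up to
  1.\<close>

lemma AE_action_near:
  assumes t: "t \<ge> 1"
  shows "AE \<omega> in M. a t \<omega> \<in> near"
proof -
  let ?A = "\<lambda>v. {\<omega> \<in> space M. a t \<omega> = v}"
  have V: "v \<in> V" if "v \<in> near" for v using that near_subset by auto
  have prob_eq: "prob (?A v) = (\<integral>\<omega>. p t \<omega> v \<partial>M)"
    and int: "integrable M (\<lambda>\<omega>. p t \<omega> v)" if "v \<in> near" for v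
    using expectation_action(2,3)[OF t V[OF that], of "\<lambda>_. 1" 1] action_event[OF t V[OF that]]
    by auto
  have "prob (\<Union>v\<in>near. ?A v) = (\<Sum>v\<in>near. prob (?A v))"
    using finite_near action_event[OF t V]
    by (intro finite_measure_finite_Union) (auto simp: disjoint_family_on_def)
  also have "\<dots> = (\<Sum>v\<in>near. \<integral>\<omega>. p t \<omega> v \<partial>M)"
    using prob_eq by simp
  also have "\<dots> = (\<integral>\<omega>. (\<Sum>v\<in>near. p t \<omega> v) \<partial>M)"
    using int by (intro Bochner_Integration.integral_sum[symmetric])
  also have "\<dots> = (\<integral>\<omega>. 1 \<partial>M)"
    using sum_policy_near[OF t] by (intro Bochner_Integration.integral_cong) auto
  also have "\<dots> = 1" by (simp add: prob_space)
  finally have "AE \<omega> in M. \<omega> \<in> (\<Union>v\<in>near. ?A v)" by (rule AE_prob_1)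
  thus ?thesis by eventually_elim auto
qed

lemma AE_actions_near: "AE \<omega> in M. \<forall>s\<in>{1..t}. a s \<omega> \<in> near"
  using AE_action_near by (intro AE_finite_allI) auto

lemma R_eq:
  assumes "\<forall>s\<in>{1..t}. a s \<omega> \<in> near"
  shows "R t \<omega> C = approx_regret b (\<lambda>s. a s \<omega>) (\<lambda>s. u s \<omega>) t C"
  unfolding R_def approx_regret_eq_sum using assms
  by (intro sum.cong[OF refl]) (simp add: near_action_def)

lemma abs_R_le: "C \<in> Cs \<Longrightarrow> \<omega> \<in> space M \<Longrightarrow> \<bar>R t \<omega> C\<bar> \<le> real t * (\<Delta> + b)"
  unfolding R_def using near_action_in_V utility_diff b_nonneg
  by (intro abs_approx_regret_le) auto

lemma abs_gain_le:
  assumes "C \<in> Cs" "\<omega> \<in> space M" "v \<in> V" "t \<ge> 1"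
  shows "\<bar>gain t \<omega> C v\<bar> \<le> \<Delta> + b"
proof -
  have "\<bar>u t \<omega> j - u t \<omega> v\<bar> \<le> \<Delta>" if "(v, j) \<in> E" for j
    using that edges assms by (intro utility_diff) auto
  thus ?thesis
    using color_successors[OF assms(1), of v] b_nonneg Delta_nonneg
    unfolding gain_def by fastforce
qed

lemma gain_history_measurable:
  assumes "C \<in> Cs" "v \<in> V" "s \<in> U"
  shows "(\<lambda>\<omega>. gain s \<omega> C v) \<in> borel_measurable (history M V a u A U)"
proof -
  have "j \<in> V" if "j \<in> C `` {v}" for j
    using that color_subset[OF assms(1)] edges by blast
  thus ?thesis unfolding gain_def using assms utility_history_measurable
    by (intro borel_measurable_sum borel_measurable_diff) auto
qed

lemma near_action_history_measurable:
  assumes "s \<ge> 1" "s \<in> A"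
  shows "near_action s \<in> measurable (history M V a u A U) (count_space UNIV)"
  unfolding near_action_def
  by (rule measurable_compose[OF action_history_measurable[OF assms],
        of "\<lambda>x. if x \<in> near then x else root"]) simp

lemma R_history_measurable:
  assumes "C \<in> Cs" "{1..t} \<subseteq> A" "{1..t} \<subseteq> U"
  shows "(\<lambda>\<omega>. R t \<omega> C) \<in> borel_measurable (history M V a u A U)"
  using assms(2,3)
proof (induction t)
  case 0
  show ?case by (simp add: R_def)
next
  case (Suc t)
  have [measurable]: "near_action (Suc t) \<in> measurable (history M V a u A U) (count_space UNIV)"
    using Suc.prems by (intro near_action_history_measurable) auto
  have [measurable]: "(\<lambda>\<omega>. gain (Suc t) \<omega> C v) \<in> borel_measurable (history M V a u A U)"
    if "v \<in> near" for v
    using assms(1) that near_subset Suc.prems by (intro gain_history_measurable) auto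
  have [measurable]: "(\<lambda>\<omega>. R t \<omega> C) \<in> borel_measurable (history M V a u A U)"
    by (rule Suc.IH) (use Suc.prems in auto)
  \<comment> \<open>The finite range of \<open>near_action\<close> is used here: the gain at a
    random vertex becomes a finite sum of gains at fixed vertices.\<close>
  have "gain (Suc t) \<omega> C (near_action (Suc t) \<omega>)
      = (\<Sum>v\<in>near. if near_action (Suc t) \<omega> = v then gain (Suc t) \<omega> C v else 0)" for \<omega>
    using finite_near near_action_near by simp
  thus ?case unfolding R_Suc by (simp only:) measurable
qed

lemma R_measurable: "C \<in> Cs \<Longrightarrow> (\<lambda>\<omega>. R t \<omega> C) \<in> borel_measurable M"
  using measurable_from_subalg[OF finite_measure_subalgebra.subalg R_history_measurable,
      OF finite_measure_subalgebra_history, of "{1..t}" "{1..t}" C t]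
  by auto

section \<open>Nonpositive expected drift\<close>

text \<open>The policy is stationary for the regrets of the actual play, which coincide with
  \<open>R\<close> as long as the past actions are near. \<open>sum_near_colors\<close> turns the
  sum over colors into the sum over edges of \<open>stationary_drift_nonpos\<close>.\<close>

lemma drift_nonpos:
  assumes \<omega>: "\<omega> \<in> space M" and near: "\<forall>s\<in>{1..t}. a s \<omega> \<in> near"
  shows "(\<Sum>v\<in>near. \<Sum>C\<in>near_colors. max 0 (R t \<omega> C) * gain (Suc t) \<omega> C v * p (Suc t) \<omega> v) \<le> 0"
proof -
  let ?R = "\<lambda>i j. R t \<omega> (color_of Cs (i, j))"
  let ?u = "u (Suc t) \<omega>" and ?p = "p (Suc t) \<omega>"
  have "(\<Sum>v\<in>near. \<Sum>C\<in>near_colors. max 0 (R t \<omega> C) * gain (Suc t) \<omega> C v * ?p v)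
      = (\<Sum>v\<in>near. \<Sum>C\<in>near_colors. \<Sum>j\<in>C `` {v}. ?p v * max 0 (R t \<omega> C) * (?u j - ?u v - b))"
    by (simp add: gain_def sum_distrib_left mult_ac)
  also have "\<dots> = (\<Sum>v\<in>near. \<Sum>j\<in>E `` {v}. ?p v * max 0 (?R v j) * (?u j - ?u v - b))"
    by (intro sum.cong refl sum_near_colors)
  also have "\<dots> \<le> 0"
    unfolding b_def
  proof (rule stationary_drift_nonpos)
    show "stationary V E root L ?R ?p"
      using stationary_policy[OF _ \<omega>, of "Suc t"] R_eq[OF near] by simp
    have "max 0 (?R i j) \<le> real t * (\<Delta> + b)" if "(i, j) \<in> E" for i j
      using abs_R_le[OF color_of_edge(1)[OF that] \<omega>, of t] Delta_nonneg b_nonneg by auto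
    thus "bdd_above ((\<lambda>(i, j). max 0 (?R i j)) ` E)"
      by (intro bdd_aboveI2[where M = "real t * (\<Delta> + b)"]) auto
  qed (use utility_diff \<omega> in auto)
  finally show ?thesis .
qed

text \<open>This is the realized quantity, which depends on the action drawn at time
  \<open>Suc t\<close>; averaging over the policy gives the sum in
  \<open>drift_nonpos\<close>.\<close>

definition drift :: "nat \<Rightarrow> 'w \<Rightarrow> real" where
  "drift t \<omega> = (\<Sum>C\<in>near_colors. max 0 (R t \<omega> C) * gain (Suc t) \<omega> C (near_action (Suc t) \<omega>))"

lemma drift_measurable: "drift t \<in> borel_measurable M"
proof -
  \<comment> \<open>As a difference of two regrets, the gain at the random action inherits their
    measurability.\<close>
  have "gain (Suc t) \<omega> C (near_action (Suc t) \<omega>) = R (Suc t) \<omega> C - R t \<omega> C" for \<omega> C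
    by (simp add: R_Suc)
  thus ?thesis
    unfolding drift_def using R_measurable near_colors_subset
    by (auto intro!: borel_measurable_sum borel_measurable_times borel_measurable_diff borel_measurable_max)
qed

lemma integrable_drift: "integrable M (drift t)"
proof (rule integrable_const_bound)
  show "AE \<omega> in M. norm (drift t \<omega>) \<le> (\<Sum>C\<in>near_colors. real t * (\<Delta> + b) * (\<Delta> + b))"
  proof (rule AE_I2)
    fix \<omega> assume \<omega>: "\<omega> \<in> space M"
    have "norm (drift t \<omega>)
      \<le> (\<Sum>C\<in>near_colors. \<bar>max 0 (R t \<omega> C) * gain (Suc t) \<omega> C (near_action (Suc t) \<omega>)\<bar>)"
      unfolding drift_def real_norm_def by (rule sum_abs)
    also have "\<dots> \<le> (\<Sum>C\<in>near_colors. real t * (\<Delta> + b) * (\<Delta> + b))"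
    proof (rule sum_mono)
      fix C assume "C \<in> near_colors"
      hence C: "C \<in> Cs" using near_colors_subset by auto
      have "\<bar>max 0 (R t \<omega> C)\<bar> \<le> real t * (\<Delta> + b)"
        using abs_R_le[OF C \<omega>, of t] Delta_nonneg b_nonneg by auto
      thus "\<bar>max 0 (R t \<omega> C) * gain (Suc t) \<omega> C (near_action (Suc t) \<omega>)\<bar>
          \<le> real t * (\<Delta> + b) * (\<Delta> + b)"
        unfolding abs_mult using abs_gain_le[OF C \<omega> near_action_in_V] Delta_nonneg b_nonneg
        by (intro mult_mono) auto
    qed
    finally show "norm (drift t \<omega>) \<le> (\<Sum>C\<in>near_colors. real t * (\<Delta> + b) * (\<Delta> + b))" .
  qed
qed (rule drift_measurable)

text \<open>The drift is split according to the drawn vertex. \<open>expectation_action\<close>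
  replaces each indicator by the policy, and the resulting integrand is nonpositive almost surely by
  \<open>drift_nonpos\<close>.\<close>

lemma expected_drift_nonpos: "expectation (drift t) \<le> 0"
proof -
  let ?f = "\<lambda>v C \<omega>. max 0 (R t \<omega> C) * gain (Suc t) \<omega> C v"
  let ?I = "\<lambda>v. indicator {\<omega> \<in> space M. a (Suc t) \<omega> = v} :: 'w \<Rightarrow> real"
  have action: "integrable M (\<lambda>\<omega>. ?f v C \<omega> * ?I v \<omega>)"
      "integrable M (\<lambda>\<omega>. ?f v C \<omega> * p (Suc t) \<omega> v)"
      "(\<integral>\<omega>. ?f v C \<omega> * ?I v \<omega> \<partial>M) = (\<integral>\<omega>. ?f v C \<omega> * p (Suc t) \<omega> v \<partial>M)"
    if v: "v \<in> near" and C: "C \<in> near_colors" for v C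
  proof -
    have V: "v \<in> V" and Cs: "C \<in> Cs" using v C near_subset near_colors_subset by auto
    \<comment> \<open>\<open>R t\<close> depends on rounds up to \<open>t\<close> and the gain at
      fixed \<open>v\<close> on the utility of round \<open>Suc t\<close>: this is the information
      on which the law of the action is conditioned.\<close>
    have meas: "?f v C \<in> borel_measurable (history M V a u {1..<Suc t} {1..Suc t})"
      by (intro borel_measurable_times borel_measurable_max borel_measurable_const
          R_history_measurable[OF Cs] gain_history_measurable[OF Cs V]) auto
    have bound: "\<bar>?f v C \<omega>\<bar> \<le> real t * (\<Delta> + b) * (\<Delta> + b)" if \<omega>: "\<omega> \<in> space M" for \<omega>
    proof -
      have "\<bar>max 0 (R t \<omega> C)\<bar> \<le> real t * (\<Delta> + b)"
        using abs_R_le[OF Cs \<omega>, of t] Delta_nonneg b_nonneg by auto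
      thus ?thesis
        unfolding abs_mult using abs_gain_le[OF Cs \<omega> V, of "Suc t"] Delta_nonneg b_nonneg
        by (intro mult_mono) auto
    qed
    show "integrable M (\<lambda>\<omega>. ?f v C \<omega> * ?I v \<omega>)"
      "integrable M (\<lambda>\<omega>. ?f v C \<omega> * p (Suc t) \<omega> v)"
      "(\<integral>\<omega>. ?f v C \<omega> * ?I v \<omega> \<partial>M) = (\<integral>\<omega>. ?f v C \<omega> * p (Suc t) \<omega> v \<partial>M)"
      by (rule expectation_action[OF _ V meas bound]; simp)+
  qed
  have "AE \<omega> in M. a (Suc t) \<omega> \<in> near" by (rule AE_action_near) simp
  hence "AE \<omega> in M. drift t \<omega> = (\<Sum>v\<in>near. \<Sum>C\<in>near_colors. ?f v C \<omega> * ?I v \<omega>)"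
    using AE_space
  proof eventually_elim
    case (elim \<omega>)
    have "(\<Sum>v\<in>near. \<Sum>C\<in>near_colors. ?f v C \<omega> * ?I v \<omega>)
        = (\<Sum>v\<in>near. if a (Suc t) \<omega> = v then \<Sum>C\<in>near_colors. ?f v C \<omega> else 0)"
      using elim by (intro sum.cong refl) (auto simp: indicator_def)
    also have "\<dots> = drift t \<omega>"
      using elim finite_near by (simp add: drift_def near_action_def)
    finally show ?case ..
  qed
  hence "expectation (drift t) = (\<integral>\<omega>. (\<Sum>v\<in>near. \<Sum>C\<in>near_colors. ?f v C \<omega> * ?I v \<omega>) \<partial>M)"
    using action(1) drift_measurable by (intro integral_cong_AE) (auto intro!: borel_measurable_integrable)
  also have "\<dots> = (\<Sum>v\<in>near. \<Sum>C\<in>near_colors. \<integral>\<omega>. ?f v C \<omega> * ?I v \<omega> \<partial>M)"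
    using action(1) by (simp add: Bochner_Integration.integral_sum)
  also have "\<dots> = (\<Sum>v\<in>near. \<Sum>C\<in>near_colors. \<integral>\<omega>. ?f v C \<omega> * p (Suc t) \<omega> v \<partial>M)"
    using action(3) by simp
  also have "\<dots> = (\<integral>\<omega>. (\<Sum>v\<in>near. \<Sum>C\<in>near_colors. ?f v C \<omega> * p (Suc t) \<omega> v) \<partial>M)"
    using action(2) by (simp add: Bochner_Integration.integral_sum)
  also have "\<dots> \<le> (\<integral>\<omega>. 0 \<partial>M)"
  proof (rule integral_mono_AE)
    show "AE \<omega> in M. (\<Sum>v\<in>near. \<Sum>C\<in>near_colors. ?f v C \<omega> * p (Suc t) \<omega> v) \<le> 0"
      using AE_actions_near[of t] AE_space by eventually_elim (rule drift_nonpos)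
  qed (use action(2) in auto)
  finally show ?thesis by simp
qed

section \<open>Growth of the potential and the expected regret\<close>

definition potential :: "nat \<Rightarrow> 'w \<Rightarrow> real" where
  "potential t \<omega> = (\<Sum>C\<in>near_colors. (max 0 (R t \<omega> C) + b)\<^sup>2)"

text \<open>Serves with \<open>c = b\<close> and \<open>n = 2\<close> for the potential, and with
  \<open>c = 0\<close> for powers of the positive parts.\<close>

lemma integrable_power_R:
  assumes C: "C \<in> Cs" and c: "c \<ge> 0"
  shows "integrable M (\<lambda>\<omega>. (max 0 (R t \<omega> C) + c) ^ n)"
proof (rule integrable_const_bound)
  show "AE \<omega> in M. norm ((max 0 (R t \<omega> C) + c) ^ n) \<le> (real t * (\<Delta> + b) + c) ^ n"
  proof (rule AE_I2)
    fix \<omega> assume "\<omega> \<in> space M"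
    from abs_R_le[OF C this, of t] show "norm ((max 0 (R t \<omega> C) + c) ^ n) \<le> (real t * (\<Delta> + b) + c) ^ n"
      unfolding norm_power using c Delta_nonneg b_nonneg by (intro power_mono) auto
  qed
  show "(\<lambda>\<omega>. (max 0 (R t \<omega> C) + c) ^ n) \<in> borel_measurable M"
    using R_measurable[OF C, of t] by measurable
qed

lemma integrable_potential: "integrable M (potential t)"
  unfolding potential_def using integrable_power_R near_colors_subset b_nonneg
  by (intro Bochner_Integration.integrable_sum) auto

lemma expected_potential_le:
  "expectation (potential t) \<le> real (card near_colors) * b\<^sup>2 + real t * (real D * \<Delta>\<^sup>2)"
proof (induction t)
  case 0
  \<comment> \<open>All regrets start at 0, so each near color starts with potential
    \<open>b\<^sup>2\<close>.\<close>
  show ?case using b_nonneg by (simp add: potential_def R_def prob_space)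
next
  case (Suc t)
  have "expectation (potential (Suc t)) \<le> (\<integral>\<omega>. potential t \<omega> + 2 * drift t \<omega> + real D * \<Delta>\<^sup>2 \<partial>M)"
  proof (rule integral_mono)
    fix \<omega> assume \<omega>: "\<omega> \<in> space M"
    show "potential (Suc t) \<omega> \<le> potential t \<omega> + 2 * drift t \<omega> + real D * \<Delta>\<^sup>2"
      unfolding potential_def drift_def R_Suc gain_def
      using near_action_near b_nonneg utility_diff[OF _ \<omega>]
      by (intro potential_increment) auto
  qed (use integrable_potential integrable_drift in auto)
  also have "\<dots> = expectation (potential t) + 2 * expectation (drift t) + real D * \<Delta>\<^sup>2"
    using integrable_potential integrable_drift by (simp add: prob_space)
  finally show ?case
    using Suc expected_drift_nonpos[of t] by (simp add: algebra_simps)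
qed

text \<open>Cauchy--Schwarz over the colors bounds the square of the sum by the potential, and
  Jensen's inequality for the square passes to the expectation.\<close>

lemma expected_positive_part_le:
  "expectation (\<lambda>\<omega>. \<Sum>C\<in>near_colors. max 0 (R t \<omega> C))
     \<le> \<Delta> * sqrt (real D * real (card near_colors)) * sqrt (real t)"
proof -
  let ?X = "\<lambda>\<omega>. \<Sum>C\<in>near_colors. max 0 (R t \<omega> C)"
  let ?n = "real (card near_colors)"
  have int: "integrable M (\<lambda>\<omega>. (max 0 (R t \<omega> C)) ^ k)" if "C \<in> near_colors" for C k
    using integrable_power_R[of C 0 t k] that near_colors_subset by auto
  have int_X: "integrable M ?X"
    using int[of _ 1] by (intro Bochner_Integration.integrable_sum) simp
  have X_sq: "(?X \<omega>)\<^sup>2 \<le> ?n * (potential t \<omega> - ?n * b\<^sup>2)" for \<omega>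
  proof -
    have "(?X \<omega>)\<^sup>2 \<le> (\<Sum>C\<in>near_colors. (max 0 (R t \<omega> C))\<^sup>2) * (\<Sum>C\<in>near_colors. 1\<^sup>2)"
      using Cauchy_Schwarz_ineq_sum[of "\<lambda>C. max 0 (R t \<omega> C)" "\<lambda>_. 1" near_colors]
      by (simp only: mult_1_right)
    also have "\<dots> = ?n * (\<Sum>C\<in>near_colors. (max 0 (R t \<omega> C))\<^sup>2)" by simp
    \<comment> \<open>The subtracted \<open>b\<^sup>2\<close> cancels the initial potential, so
      \<open>b\<close> does not appear in the final bound.\<close>
    also have "\<dots> \<le> ?n * (\<Sum>C\<in>near_colors. (max 0 (R t \<omega> C) + b)\<^sup>2 - b\<^sup>2)"
    proof (intro mult_left_mono sum_mono)
      fix C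
      have "0 \<le> 2 * max 0 (R t \<omega> C) * b" using b_nonneg by simp
      thus "(max 0 (R t \<omega> C))\<^sup>2 \<le> (max 0 (R t \<omega> C) + b)\<^sup>2 - b\<^sup>2"
        unfolding power2_sum by linarith
    qed simp
    finally show ?thesis by (simp add: potential_def sum_subtractf)
  qed
  have int_bound: "integrable M (\<lambda>\<omega>. ?n * (potential t \<omega> - ?n * b\<^sup>2))"
    using integrable_potential by auto
  have int_X2: "integrable M (\<lambda>\<omega>. (?X \<omega>)\<^sup>2)"
  proof (rule Bochner_Integration.integrable_bound[OF int_bound])
    show "(\<lambda>\<omega>. (?X \<omega>)\<^sup>2) \<in> borel_measurable M"
      using int_X by (intro borel_measurable_power borel_measurable_integrable)
    have "norm ((?X \<omega>)\<^sup>2) \<le> norm (?n * (potential t \<omega> - ?n * b\<^sup>2))" for \<omega>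
      unfolding real_norm_def abs_of_nonneg[OF zero_le_power2]
      using X_sq abs_ge_self by (rule order_trans)
    thus "AE \<omega> in M. norm ((?X \<omega>)\<^sup>2) \<le> norm (?n * (potential t \<omega> - ?n * b\<^sup>2))"
      by simp
  qed
  \<comment> \<open>Jensen's inequality in the form that the variance is nonnegative.\<close>
  have "(expectation ?X)\<^sup>2 \<le> expectation (\<lambda>\<omega>. (?X \<omega>)\<^sup>2)"
    using variance_eq[OF int_X int_X2] variance_positive[of ?X] by linarith
  also have "\<dots> \<le> expectation (\<lambda>\<omega>. ?n * (potential t \<omega> - ?n * b\<^sup>2))"
    using X_sq by (intro integral_mono int_X2 int_bound)
  also have "\<dots> = ?n * (expectation (potential t) - ?n * b\<^sup>2)"
    using integrable_potential
    by (subst integral_mult_right_zero, subst Bochner_Integration.integral_diff)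
       (simp_all add: prob_space)
  also have "\<dots> \<le> ?n * (real t * (real D * \<Delta>\<^sup>2))"
    using expected_potential_le[of t] by (intro mult_left_mono) auto
  also have "\<dots> = (\<Delta> * sqrt (real D * ?n) * sqrt (real t))\<^sup>2"
    by (simp only: power_mult_distrib real_sqrt_pow2 of_nat_0_le_iff mult_nonneg_nonneg mult_ac)
  finally show ?thesis
    by (rule power2_le_imp_le) (intro mult_nonneg_nonneg Delta_nonneg real_sqrt_ge_zero; simp)
qed

text \<open>The nonnegative integral is monotone almost everywhere for arbitrary functions. The
  regret, a function of the action itself, is thus compared with the bound outside a null set, and
  measurability is asked of the bound alone.\<close>

theorem expected_local_color_regret_le:
  "(\<integral>\<^sup>+\<omega>. ennreal (local_color_regret Cs (\<lambda>t. a t \<omega>) (\<lambda>t. u t \<omega>) T) \<partial>M)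
    \<le> ennreal (b * real D * real T + \<Delta> * sqrt (real D * real (card near_colors)) * sqrt (real T))"
proof -
  let ?X = "\<lambda>\<omega>. \<Sum>C\<in>near_colors. max 0 (R T \<omega> C)"
  have int: "integrable M ?X"
    using integrable_power_R[of _ 0 T 1] near_colors_subset
    by (intro Bochner_Integration.integrable_sum) auto
  have "(\<integral>\<^sup>+\<omega>. ennreal (local_color_regret Cs (\<lambda>t. a t \<omega>) (\<lambda>t. u t \<omega>) T) \<partial>M)
      \<le> (\<integral>\<^sup>+\<omega>. ennreal (?X \<omega> + b * real D * real T) \<partial>M)"
  proof (rule nn_integral_mono_AE)
    show "AE \<omega> in M. ennreal (local_color_regret Cs (\<lambda>t. a t \<omega>) (\<lambda>t. u t \<omega>) T)
        \<le> ennreal (?X \<omega> + b * real D * real T)"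
      using AE_actions_near[of T]
    proof eventually_elim
      case (elim \<omega>)
      thus ?case
        using local_color_regret_le[of T "\<lambda>t. a t \<omega>" b "\<lambda>t. u t \<omega>"] b_nonneg
        by (intro ennreal_leI) (simp add: R_eq[OF elim])
    qed
  qed
  also have "\<dots> = ennreal (expectation (\<lambda>\<omega>. ?X \<omega> + b * real D * real T))"
    using int b_nonneg by (intro nn_integral_eq_integral) (auto intro!: AE_I2 add_nonneg_nonneg sum_nonneg)
  also have "expectation (\<lambda>\<omega>. ?X \<omega> + b * real D * real T) = expectation ?X + b * real D * real T"
    by (subst Bochner_Integration.integral_add[OF int]) (auto simp: prob_space)
  finally show ?thesis
    using expected_positive_part_le[of T]
    by (elim order_trans) (intro ennreal_leI, simp)
qed

end

theorem theorem5:
  fixes V :: "'a set" and E :: "('a \<times> 'a) set" and root :: 'a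
    and D L T :: nat and Cs :: "('a \<times> 'a) set set" and \<Delta> :: real
    and M :: "'w measure" and a :: "nat \<Rightarrow> 'w \<Rightarrow> 'a" and u p :: "nat \<Rightarrow> 'w \<Rightarrow> 'a \<Rightarrow> real"
  assumes "E \<subseteq> V \<times> V"
    and "max_out_degree V E D"
    and "root \<in> V"
    and "edge_coloring E Cs"
    and "online_play M V a u p"
    and "\<And>t \<omega> x y. t \<ge> 1 \<Longrightarrow> \<omega> \<in> space M \<Longrightarrow> x \<in> V \<Longrightarrow> y \<in> V \<Longrightarrow>
           \<bar>u t \<omega> x - u t \<omega> y\<bar> \<le> \<Delta>"
    and "\<And>\<omega>. \<omega> \<in> space M \<Longrightarrow>
           colored_regret_matching V E root (\<Delta> / (real L + 1)) L Cs
             (\<lambda>t. a t \<omega>) (\<lambda>t. u t \<omega>) (\<lambda>t. p t \<omega>)"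
    and "T \<ge> 1"
  shows "ennreal (1 / real T) *
           (\<integral>\<^sup>+\<omega>. ennreal (local_color_regret Cs (\<lambda>t. a t \<omega>) (\<lambda>t. u t \<omega>) T) \<partial>M)
         \<le> ennreal (\<Delta> * real D / (real L + 1)
             + \<Delta> * sqrt (real D * real (card {C \<in> Cs. \<exists>(i, j)\<in>C. level E root i \<le> enat L}))
               / sqrt (real T))"
proof -
  interpret colored_play V E root D L Cs M a u p \<Delta>
    using assms(1-7)
    by (intro colored_play.intro colored_rooted_graph.intro colored_play_axioms.intro)
  let ?bound = "b * real D * real T + \<Delta> * sqrt (real D * real (card near_colors)) * sqrt (real T)"
  have "ennreal (1 / real T) *
      (\<integral>\<^sup>+\<omega>. ennreal (local_color_regret Cs (\<lambda>t. a t \<omega>) (\<lambda>t. u t \<omega>) T) \<partial>M)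
      \<le> ennreal (1 / real T) * ennreal ?bound"
    by (intro mult_left_mono expected_local_color_regret_le) simp
  also have "\<dots> = ennreal (1 / real T * ?bound)"
    by (rule ennreal_mult'[symmetric]) simp
  also have "1 / real T * ?bound = \<Delta> * real D / (real L + 1)
      + \<Delta> * sqrt (real D * real (card near_colors)) / sqrt (real T)"
  proof -
    have "1 / real T * ?bound = b * real D
        + \<Delta> * sqrt (real D * real (card near_colors)) * (sqrt (real T) / real T)"
      using assms(8) by (simp add: add_divide_distrib)
    also have "sqrt (real T) / real T = inverse (sqrt (real T))"
      by (rule sqrt_divide_self_eq) simp
    finally show ?thesis by (simp add: b_def divide_inverse mult_ac)
  qed
  finally show ?thesis unfolding near_colors_def .
qed

end
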